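(* Let $n$ be odd and $i$ an integer with $1\le i<n$ and $\gcd(i,n)=1$, and let $F:\mathbb{F}_{2^n}\to\mathbb{F}_{2^n}$, $F(x)=x^{2^i+1}$. The set $S=\{(x,F(x)):x\in\mathbb{F}_{2^n}\}$ is formally self dual under the trace pairing $\langle (x,y),(a,b)\rangle=(-1)^{\mathrm{Tr}(ax+by)}$ if and only if $n=3$. In this case, both $i=1$ and $i=2$ yield formally self dual sets.
   Context: $\mathrm{Tr}:\mathbb{F}_{2^n}\to\mathbb{F}_2$ is the absolute trace $x\mapsto\sum_{j=0}^{n-1}x^{2^j}$. A set $S\subset G=\mathbb{F}_{2^n}^2$ (additive group) is formally self dual under the trace pairing if for all $(a,b)\in G$: $\big|\sum_{(x,y)\in S}(-1)^{\mathrm{Tr}(ax+by)}\big|^2=|S|\cdot|\{(s,t)\in S^2:s-t=(a,b)\}|$ (i.e. $S$ and $\Delta(S)$ form a formally dual pair for the isomorphism $\Delta:G\to\hat G$ determined by the pairing). *)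

theory Defs
  imports Complex_Main "HOL-Library.Product_Plus" "HOL-Library.Cardinality"
    "HOL-Computational_Algebra.Primes"
begin

text \<open>Throughout, the type \<open>'a\<close> plays the role of the field with \<open>2 ^ n\<close> elements.\<close>

text \<open>The absolute trace takes its values in the prime field, which is regarded as the subset
  \<open>{0, 1}\<close> of \<open>'a\<close>.\<close>
definition abs_trace :: "nat \<Rightarrow> 'a::finite_field \<Rightarrow> 'a" where
  "abs_trace n x = (\<Sum>j<n. x ^ (2 ^ j))"

text \<open>The sign \<open>(-1)\<close> to the power \<open>t\<close>, for an exponent \<open>t\<close> in the prime field \<open>{0, 1}\<close>.\<close>
definition sign_pow :: "'a::finite_field \<Rightarrow> complex" where
  "sign_pow t = (if t = 0 then 1 else - 1)"

definition trace_pairing :: "nat \<Rightarrow> 'a::finite_field \<times> 'a \<Rightarrow> 'a \<times> 'a \<Rightarrow> complex" where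
  "trace_pairing n = (\<lambda>(x, y) (a, b). sign_pow (abs_trace n (a * x + b * y)))"

definition formally_self_dual :: "nat \<Rightarrow> ('a::finite_field \<times> 'a) set \<Rightarrow> bool" where
  "formally_self_dual n S \<longleftrightarrow>
     (\<forall>g. (cmod (\<Sum>s\<in>S. trace_pairing n s g))\<^sup>2
        = real (card S) * real (card {(s, t). s \<in> S \<and> t \<in> S \<and> s - t = g}))"

definition power_graph :: "nat \<Rightarrow> ('a::finite_field \<times> 'a) set" where
  "power_graph i = {(x, x ^ (2 ^ i + 1)) | x. True}"

end

theory Submission
  imports Defs "HOL-Computational_Algebra.Polynomial" "HOL-Number_Theory.Cong"
begin

text \<open>
  Write \<open>d = 2 ^ i + 1\<close> and let \<open>\<chi> x\<close> be the sign \<open>(-1)\<close> to the power \<open>Tr x\<close>. Orthogonality of the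
  characters \<open>x \<mapsto> \<chi> (c * x)\<close>, together with the fact that \<open>0\<close> and \<open>1\<close> are the only fixed points of
  \<open>x \<mapsto> x ^ 2 ^ i\<close> and of its square, yields the value \<open>2 ^ n * (1 - \<chi> v)\<close> for the squared
  character sum at \<open>(v, 1)\<close> and, for \<open>a \<noteq> 0\<close>, the number \<open>1 - \<chi> (b / a ^ d)\<close> of representations of
  \<open>(a, b)\<close> as a difference. Since \<open>x \<mapsto> x ^ d\<close> is a permutation, formal self duality amounts to
  \<open>Tr v = Tr (inverse v ^ d)\<close> for all \<open>v \<noteq> 0\<close>. For \<open>n = 3\<close> the right-hand argument is \<open>v ^ 4\<close> or
  \<open>v ^ 2\<close>, a conjugate of \<open>v\<close>. For \<open>n \<ge> 4\<close> multiply by \<open>inverse v\<close> and sum over all \<open>v \<noteq> 0\<close>: the left-hand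
  side gives \<open>1\<close>, and the right-hand side gives \<open>0\<close>, because \<open>2 ^ n - 1\<close> does not divide
  \<open>2 ^ k + 2 ^ j + 1\<close> for distinct \<open>k, j < n\<close>.
\<close>

section \<open>Power sums over a finite field\<close>

lemma finite_field_power_card_minus_1:
  fixes x :: "'a::finite_field"
  assumes "x \<noteq> 0"
  shows "x ^ (CARD('a) - 1) = 1"
proof -
  have "x * x ^ (CARD('a) - 1) = x * 1"
    using finite_field_power_card_eq_same[of x] finite_UNIV_card_ge_0[where ?'a = 'a]
    by (simp flip: power_Suc)
  then show ?thesis using assms by simp
qed

text \<open>Otherwise, with \<open>r\<close> the nonzero remainder of \<open>m\<close> modulo
  \<open>CARD('a) - 1\<close>, \<open>monom 1 r\<close> and \<open>1\<close> would agree at more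
  points than their degrees allow.\<close>

lemma finite_field_exists_power_neq_1:
  assumes "\<not> (CARD('a::finite_field) - 1) dvd m"
  shows "\<exists>w::'a. w \<noteq> 0 \<and> w ^ m \<noteq> 1"
proof (rule ccontr)
  assume *: "\<not> ?thesis"
  let ?N = "CARD('a) - 1"
  have card0: "card (UNIV - {0::'a}) = ?N" by simp
  have "card {0, 1::'a} \<le> CARD('a)" by (rule card_mono) auto
  then have N: "?N > 0" by simp
  define r where "r = m mod ?N"
  have r: "0 < r" "r < ?N" using assms N unfolding r_def by (auto simp: mod_greater_zero_iff_not_dvd)
  have root: "w ^ r = 1" if "w \<noteq> 0" for w :: 'a
  proof -
    have "w ^ m = w ^ (?N * (m div ?N) + r)" unfolding r_def by simp
    also have "\<dots> = w ^ r"
      by (simp only: power_add power_mult finite_field_power_card_minus_1[OF that]) simp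
    finally show ?thesis using * that by auto
  qed
  have "monom (1::'a) r = 1"
    using r root by (intro poly_eqI_degree[where A = "UNIV - {0::'a}"])
      (auto simp: poly_monom degree_monom_eq card0)
  then have "degree (monom (1::'a) r) = 0" by simp
  then show False using r by (simp add: degree_monom_eq)
qed

text \<open>Scaling the variable by \<open>w\<close> multiplies the sum by \<open>w ^ m\<close>,
  which is not \<open>1\<close>.\<close>

lemma finite_field_power_sum_eq_0:
  assumes "\<not> (CARD('a::finite_field) - 1) dvd m"
  shows "(\<Sum>x\<in>UNIV - {0::'a}. x ^ m) = 0"
proof -
  obtain w :: 'a where w: "w \<noteq> 0" "w ^ m \<noteq> 1"
    using finite_field_exists_power_neq_1[OF assms] by blast
  have "(\<Sum>x\<in>UNIV - {0::'a}. x ^ m) = (\<Sum>x\<in>UNIV - {0::'a}. (w * x) ^ m)"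
    by (rule sum.reindex_bij_witness[of _ "\<lambda>x. w * x" "\<lambda>x. x / w"]) (use w in auto)
  also have "\<dots> = w ^ m * (\<Sum>x\<in>UNIV - {0::'a}. x ^ m)"
    by (simp add: power_mult_distrib sum_distrib_left)
  finally show ?thesis using w by simp
qed

section \<open>The additive character of a field of even order\<close>

text \<open>Real-valued, so that squared moduli of character sums become ordinary squares.\<close>

definition trace_sign :: "nat \<Rightarrow> 'a::finite_field \<Rightarrow> real" where
  "trace_sign n x = (if abs_trace n x = 0 then 1 else - 1)"

lemma sign_pow_abs_trace: "sign_pow (abs_trace n x) = of_real (trace_sign n x)"
  by (simp add: sign_pow_def trace_sign_def)

locale binary_field =
  fixes n :: nat and ty :: "'a::finite_field itself"
  assumes card_UNIV: "CARD('a) = 2 ^ n" and odd_n: "odd n"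
begin

abbreviation Tr :: "'a \<Rightarrow> 'a" where "Tr \<equiv> abs_trace n"
abbreviation \<chi> :: "'a \<Rightarrow> real" where "\<chi> \<equiv> trace_sign n"

section \<open>Characteristic two and the Frobenius maps\<close>

lemma n_pos: "n > 0"
  using odd_n by (rule odd_pos)

lemma CHAR_2: "CHAR('a) = 2"
proof -
  \<comment> \<open>Translation by \<open>1\<close> permutes the field, so \<open>CARD('a)\<close>
    copies of \<open>1\<close> add up to \<open>0\<close>.\<close>
  have "(\<Sum>x\<in>(UNIV::'a set). x) = (\<Sum>x\<in>UNIV. x + 1)"
    by (rule sum.reindex_bij_witness[of _ "\<lambda>x. x + 1" "\<lambda>x. x - 1"]) auto
  then have "of_nat (CARD('a)) = (0::'a)" by (simp add: sum.distrib)
  then have "CHAR('a) dvd 2 ^ n" by (simp only: of_nat_eq_0_iff_char_dvd card_UNIV)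
  then have "CHAR('a) dvd 2" using prime_dvd_power[of "CHAR('a)" 2 n] by simp
  then show ?thesis using primes_dvd_imp_eq[of "CHAR('a)" 2] by simp
qed

lemma add_self [simp]: "x + x = (0::'a)"
  using uminus_CHAR_2[OF CHAR_2, of x] by (metis add.right_inverse)

lemma add_self_left [simp]: "x + (x + y) = (y::'a)"
  by (simp flip: add.assoc)

lemma minus_eq_add: "x - y = x + (y::'a)"
  using minus_CHAR_2[OF CHAR_2] .

lemma add_eq_0_iff_eq: "x + y = 0 \<longleftrightarrow> x = (y::'a)"
  by (metis minus_eq_add right_minus_eq)

lemma frobenius_add: "(x + y :: 'a) ^ 2 ^ k = x ^ 2 ^ k + y ^ 2 ^ k"
  by (rule freshmans_dream') (simp_all add: CHAR_2)

lemma frobenius_comp: "(x ^ 2 ^ k) ^ 2 ^ l = (x::'a) ^ 2 ^ (k + l)"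
  by (simp add: power_mult power_add)

lemma frobenius_period: "x ^ 2 ^ (n * k) = (x::'a)"
  by (rule finite_field_power_card_power_eq_same[of _ k]) (simp add: card_UNIV power_mult)

lemma frobenius_n: "x ^ 2 ^ n = (x::'a)"
  using frobenius_period[of x 1] by simp

lemma bij_frobenius: "bij (\<lambda>x::'a. x ^ 2 ^ k)"
proof -
  have "inj (\<lambda>x::'a. x ^ 2 ^ k)"
  proof (rule injI)
    fix x y :: 'a assume "x ^ 2 ^ k = y ^ 2 ^ k"
    then have "(x + y) ^ 2 ^ k = 0" by (simp add: frobenius_add)
    then show "x = y" by (simp add: add_eq_0_iff_eq)
  qed
  then show ?thesis by (simp add: bij_def finite_UNIV_inj_surj)
qed

text \<open>By Bezout some iterate of the map \<open>x ^ 2 ^ k\<close> is squaring, and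
  \<open>x ^ 2 = x\<close> leaves only \<open>0\<close> and \<open>1\<close>.\<close>

lemma frobenius_fixed_iff:
  assumes "coprime k n"
  shows "(x::'a) ^ 2 ^ k = x \<longleftrightarrow> x = 0 \<or> x = 1"
proof
  assume x: "x ^ 2 ^ k = x"
  show "x = 0 \<or> x = 1"
  proof (cases "k = 0")
    \<comment> \<open>Here coprimality forces \<open>n = 1\<close>, the field of two
      elements.\<close>
    case True
    with assms have "x ^ 2 = x" using frobenius_n[of x] by simp
    then show ?thesis by (simp add: power2_eq_square)
  next
    case False
    then obtain a b where ab: "k * a = n * b + 1"
      using bezout_nat[of k n] assms by auto
    have "x ^ 2 ^ (k * l) = x" for l
      by (induction l) (simp_all add: x flip: frobenius_comp)
    from this[of a] have "x = x ^ 2 ^ (n * b + 1)" unfolding ab by (rule sym)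
    also have "\<dots> = x ^ 2" by (simp only: frobenius_period flip: frobenius_comp) simp
    finally show ?thesis by (simp add: power2_eq_square)
  qed
qed auto

section \<open>The absolute trace\<close>

lemma Tr_add: "Tr (x + y) = Tr x + Tr y"
  by (simp add: abs_trace_def frobenius_add sum.distrib)

text \<open>Squaring shifts the conjugates cyclically; adding \<open>x\<close> to either side gives
  the sum of the first \<open>n + 1\<close> of them.\<close>

lemma Tr_square: "Tr (x ^ 2) = Tr x"
proof -
  have "Tr (x ^ 2) + x = (\<Sum>j<Suc n. x ^ 2 ^ j)"
    by (subst sum.lessThan_Suc_shift) (simp add: abs_trace_def flip: power_mult)
  also have "\<dots> = Tr x + x" by (simp add: abs_trace_def frobenius_n)
  finally show ?thesis by simp
qed

lemma Tr_frobenius: "Tr (x ^ 2 ^ k) = Tr x"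
  by (induction k) (simp_all add: Tr_square power_mult mult.commute[of 2])

lemma Tr_cases: "Tr x = 0 \<or> Tr x = 1"
proof -
  have "Tr x ^ 2 ^ 1 = Tr (x ^ 2 ^ 1)" unfolding abs_trace_def
    by (subst freshmans_dream_sum'[where m = "2 ^ 1" and n = 1])
      (simp_all add: CHAR_2 mult.commute flip: power_mult)
  then have "Tr x ^ 2 = Tr x" by (simp add: Tr_square)
  then show ?thesis by (simp add: power2_eq_square)
qed

text \<open>A sum of \<open>n\<close> ones with \<open>n\<close> odd. This makes the character
  nontrivial.\<close>

lemma Tr_1: "Tr 1 = 1"
proof -
  have "of_nat n = (of_nat (2 * (n div 2) + 1) :: 'a)" using odd_n by simp
  also have "\<dots> = 1" by (simp only: of_nat_add of_nat_mult mult_2) simp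
  finally show ?thesis by (simp add: abs_trace_def)
qed

section \<open>The character and its orthogonality relations\<close>

lemma chi_add: "\<chi> (x + y) = \<chi> x * \<chi> y"
  using Tr_cases[of x] Tr_cases[of y] by (auto simp: trace_sign_def Tr_add)

lemma chi_0 [simp]: "\<chi> 0 = 1"
  using Tr_add[of 0 0] by (simp add: trace_sign_def)

lemma chi_1 [simp]: "\<chi> 1 = - 1"
  by (simp add: trace_sign_def Tr_1)

lemma chi_frobenius: "\<chi> (x ^ 2 ^ k) = \<chi> x"
  by (simp add: trace_sign_def Tr_frobenius)

lemma chi_eq_iff: "\<chi> x = \<chi> y \<longleftrightarrow> Tr x = Tr y"
  using Tr_cases[of x] Tr_cases[of y] by (auto simp: trace_sign_def)

text \<open>Translation by \<open>1\<close> flips every sign.\<close>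

lemma sum_chi: "(\<Sum>x\<in>UNIV. \<chi> x) = 0"
proof -
  have "(\<Sum>x\<in>UNIV. \<chi> x) = (\<Sum>x\<in>UNIV. \<chi> (x + 1))"
    by (rule sum.reindex_bij_witness[of _ "\<lambda>x. x + 1" "\<lambda>x. x - 1"]) auto
  then show ?thesis by (simp add: chi_add sum_negf)
qed

lemma sum_chi_mult: "(\<Sum>x\<in>UNIV. \<chi> (c * x)) = (if c = 0 then 2 ^ n else 0)"
proof (cases "c = 0")
  case False
  have "(\<Sum>x\<in>UNIV. \<chi> (c * x)) = (\<Sum>x\<in>UNIV. \<chi> x)"
    by (rule sum.reindex_bij_witness[of _ "\<lambda>x. x / c" "\<lambda>x. c * x"]) (use False in auto)
  with False show ?thesis by (simp add: sum_chi)
qed (simp add: card_UNIV)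

lemma sum_chi_mult_frobenius:
  "(\<Sum>x\<in>UNIV. \<chi> (c * x ^ 2 ^ k)) = (if c = 0 then 2 ^ n else 0)"
  using sum.reindex_bij_betw[OF bij_frobenius[of k], of "\<lambda>x. \<chi> (c * x)"]
  by (simp add: sum_chi_mult)

text \<open>Invariance of the trace under Frobenius merges the two terms into one linear form in
  \<open>x ^ 2 ^ k\<close>.\<close>
lemma sum_chi_linearized:
  "(\<Sum>x\<in>UNIV. \<chi> (a * x ^ 2 ^ k + b * x)) = (if a = b ^ 2 ^ k then 2 ^ n else 0)"
proof -
  have "\<chi> (a * x ^ 2 ^ k + b * x) = \<chi> ((a + b ^ 2 ^ k) * x ^ 2 ^ k)" for x
    using chi_frobenius[of "b * x" k] by (simp add: chi_add distrib_right power_mult_distrib)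
  then show ?thesis by (simp add: sum_chi_mult_frobenius add_eq_0_iff_eq)
qed

end

section \<open>Gold power functions\<close>

lemma card_power_graph: "card (power_graph i :: ('a::finite_field \<times> 'a) set) = CARD('a)"
proof -
  have "power_graph i = range (\<lambda>x::'a. (x, x ^ (2 ^ i + 1)))"
    by (auto simp: power_graph_def)
  then show ?thesis by (simp add: card_image inj_on_def)
qed

locale gold_function = binary_field n ty for n and ty :: "'a::finite_field itself" +
  fixes i :: nat
  assumes coprime_i: "coprime i n"
begin

abbreviation d :: nat where "d \<equiv> 2 ^ i + 1"

definition char_sum :: "'a \<Rightarrow> 'a \<Rightarrow> real" where
  "char_sum a b = (\<Sum>x\<in>UNIV. \<chi> (a * x + b * x ^ d))"

definition differences :: "'a \<times> 'a \<Rightarrow> (('a \<times> 'a) \<times> ('a \<times> 'a)) set" where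
  "differences g = {(s, t). s \<in> power_graph i \<and> t \<in> power_graph i \<and> s - t = g}"

section \<open>Derivatives, difference counts and character sums of the power map\<close>

lemma coprime_2i: "coprime (i + i) n"
  using coprime_i odd_n by (simp flip: mult_2)

text \<open>The mixed term is additive in \<open>x\<close>, so \<open>x ^ d\<close> behaves like a
  quadratic form.\<close>

lemma power_d_add:
  "(x + u :: 'a) ^ d = x ^ d + (u * x ^ 2 ^ i + u ^ 2 ^ i * x) + u ^ d"
  by (simp add: frobenius_add algebra_simps)

text \<open>Orthogonality detects the equation; after swapping the sums only the Frobenius-fixed
  \<open>w\<close>, namely \<open>0\<close> and \<open>1\<close>, survive.\<close>

lemma card_artin_schreier: "real (card {z::'a. z ^ 2 ^ i + z = t}) = 1 + \<chi> t"
proof -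
  have "2 ^ n * real (card {z::'a. z ^ 2 ^ i + z = t})
      = (\<Sum>z\<in>UNIV. if z ^ 2 ^ i + z + t = 0 then 2 ^ n else 0)"
    by (simp add: sum.If_cases add_eq_0_iff_eq)
  also have "\<dots> = (\<Sum>z\<in>UNIV. \<Sum>w\<in>UNIV. \<chi> ((z ^ 2 ^ i + z + t) * w))"
    by (simp add: sum_chi_mult)
  also have "\<dots> = (\<Sum>w\<in>UNIV. \<Sum>z\<in>UNIV. \<chi> (t * w) * \<chi> (w * z ^ 2 ^ i + w * z))"
    by (subst sum.swap) (simp add: algebra_simps flip: chi_add)
  also have "\<dots> = (\<Sum>w\<in>UNIV. \<chi> (t * w) * (if w ^ 2 ^ i = w then 2 ^ n else 0))"
    by (simp add: sum_chi_linearized eq_commute flip: sum_distrib_left)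
  also have "\<dots> = (\<Sum>w\<in>{0,1}. \<chi> (t * w) * 2 ^ n)"
    by (rule sum.mono_neutral_cong_right) (auto simp: frobenius_fixed_iff[OF coprime_i])
  also have "\<dots> = 2 ^ n * (1 + \<chi> t)" by (simp add: algebra_simps)
  finally show ?thesis by simp
qed

text \<open>The substitution \<open>x = a * z\<close> leads to \<open>card_artin_schreier\<close>;
  the extra summand \<open>1\<close> turns the sign into a minus.\<close>

lemma card_derivative:
  assumes "a \<noteq> 0"
  shows "real (card {x::'a. x ^ d + (x + a) ^ d = b}) = 1 - \<chi> (b / a ^ d)"
proof -
  have "bij_betw (\<lambda>z. a * z) {z. z ^ 2 ^ i + z = b / a ^ d + 1} {x::'a. x ^ d + (x + a) ^ d = b}"
  proof (rule bij_betw_byWitness[where f' = "\<lambda>x. x / a"])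
    have *: "(a * z) ^ d + (a * z + a) ^ d = a ^ d * (z ^ 2 ^ i + z + 1)" for z
      unfolding power_d_add by (simp add: algebra_simps power_mult_distrib)
    have **: "(a * z) ^ d + (a * z + a) ^ d = b \<longleftrightarrow> z ^ 2 ^ i + z = b / a ^ d + 1" for z
    proof -
      have "(a * z) ^ d + (a * z + a) ^ d = b \<longleftrightarrow> z ^ 2 ^ i + z + 1 = b / a ^ d"
        unfolding * using assms by (simp add: eq_divide_eq mult.commute)
      also have "\<dots> \<longleftrightarrow> z ^ 2 ^ i + z = b / a ^ d + 1"
        by (metis eq_diff_eq minus_eq_add)
      finally show ?thesis .
    qed
    show "(\<lambda>z. a * z) ` {z. z ^ 2 ^ i + z = b / a ^ d + 1} \<subseteq> {x. x ^ d + (x + a) ^ d = b}"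
      using ** by blast
    show "(\<lambda>x. x / a) ` {x. x ^ d + (x + a) ^ d = b} \<subseteq> {z. z ^ 2 ^ i + z = b / a ^ d + 1}"
    proof (clarify)
      fix x assume "b = x ^ d + (x + a) ^ d"
      then show "(x / a) ^ 2 ^ i + x / a = (x ^ d + (x + a) ^ d) / a ^ d + 1"
        using **[of "x / a"] assms by (simp del: power_add power_Suc)
    qed
  qed (use assms in auto)
  then show ?thesis
    using card_artin_schreier[of "b / a ^ d + 1"] by (simp add: bij_betw_same_card chi_add)
qed

text \<open>A collision of \<open>x\<close> and \<open>y\<close> would be a zero of the derivative
  in direction \<open>x + y\<close>, but there are \<open>1 - \<chi> 0 = 0\<close> of these.\<close>

lemma bij_power_d: "bij (\<lambda>x::'a. x ^ d)"
proof -
  have "inj (\<lambda>x::'a. x ^ d)"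
  proof (rule injI, rule ccontr)
    fix x y :: 'a assume xy: "x ^ d = y ^ d" "x \<noteq> y"
    then have "x + y \<noteq> 0" by (simp add: add_eq_0_iff_eq)
    then have "card {z::'a. z ^ d + (z + (x + y)) ^ d = 0} = 0"
      using card_derivative[of "x + y" 0] by simp
    then have "{z::'a. z ^ d + (z + (x + y)) ^ d = 0} = {}"
      by (simp only: card_0_eq[OF finite])
    moreover have "x \<in> {z. z ^ d + (z + (x + y)) ^ d = 0}"
      using xy by (simp only: mem_Collect_eq add_self_left add_self)
    ultimately show False by (simp only: empty_iff)
  qed
  then show ?thesis by (simp add: bij_def finite_UNIV_inj_surj)
qed

lemma card_differences:
  "real (card (differences (a, b)))
     = (if a = 0 then if b = 0 then 2 ^ n else 0 else 1 - \<chi> (b / a ^ d))"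
proof -
  \<comment> \<open>A representation is determined by the first coordinate of its first
    point.\<close>
  let ?f = "\<lambda>x. ((x, x ^ d), (x + a, (x + a) ^ d))"
  have "differences (a, b) = ?f ` {x. x ^ d + (x + a) ^ d = b}"
  proof (intro set_eqI iffI)
    fix p assume "p \<in> differences (a, b)"
    then obtain x y where p: "p = ((x, x ^ d), (y, y ^ d))" and "x - y = a" "x ^ d - y ^ d = b"
      unfolding differences_def power_graph_def by auto
    then have "y = x + a" "x ^ d + (x + a) ^ d = b" by (auto simp only: minus_eq_add add_self_left)
    with p show "p \<in> ?f ` {x. x ^ d + (x + a) ^ d = b}" by blast
  next
    fix p assume "p \<in> ?f ` {x. x ^ d + (x + a) ^ d = b}"
    then obtain x where p: "p = ?f x" and "x ^ d + (x + a) ^ d = b" by blast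
    then have "x ^ d - (x + a) ^ d = b" "x - (x + a) = a"
      by (simp_all only: minus_eq_add add_self_left)
    then show "p \<in> differences (a, b)"
      unfolding differences_def power_graph_def p by (simp del: power_add power_Suc)
  qed
  moreover have "card (?f ` {x. x ^ d + (x + a) ^ d = b}) = card {x. x ^ d + (x + a) ^ d = b}"
    by (rule card_image) (simp add: inj_on_def)
  ultimately have "card (differences (a, b)) = card {x. x ^ d + (x + a) ^ d = b}"
    by (simp only:)
  then show ?thesis
    using card_derivative[of a b] by (cases "a = 0"; cases "b = 0") (auto simp: card_UNIV)
qed

lemma char_sum_square: "(char_sum v 1)\<^sup>2 = 2 ^ n * (1 - \<chi> v)"
proof -
  have *: "\<chi> (v * x + x ^ d) * \<chi> (v * (x + u) + (x + u) ^ d)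
      = \<chi> (v * u + u ^ d) * \<chi> (u * x ^ 2 ^ i + u ^ 2 ^ i * x)" for x u
    unfolding power_d_add chi_add[symmetric] by (simp add: algebra_simps)
  have "(char_sum v 1)\<^sup>2
      = (\<Sum>x\<in>UNIV. \<Sum>y\<in>UNIV. \<chi> (v * x + x ^ d) * \<chi> (v * y + y ^ d))"
    by (simp only: char_sum_def power2_eq_square sum_product mult_1)
  \<comment> \<open>With \<open>y = x + u\<close> the terms quadratic in \<open>x\<close> cancel,
    and the sum over \<open>x\<close> becomes linear.\<close>
  also have "\<dots> = (\<Sum>x\<in>UNIV. \<Sum>u\<in>UNIV. \<chi> (v * x + x ^ d) * \<chi> (v * (x + u) + (x + u) ^ d))"
  proof (rule sum.cong[OF refl])
    fix x :: 'a
    show "(\<Sum>y\<in>UNIV. \<chi> (v * x + x ^ d) * \<chi> (v * y + y ^ d))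
        = (\<Sum>u\<in>UNIV. \<chi> (v * x + x ^ d) * \<chi> (v * (x + u) + (x + u) ^ d))"
      by (rule sum.reindex_bij_witness[of _ "\<lambda>u. x + u" "\<lambda>y. y - x"]) auto
  qed
  also have "\<dots> = (\<Sum>u\<in>UNIV. \<chi> (v * u + u ^ d) * (\<Sum>x\<in>UNIV. \<chi> (u * x ^ 2 ^ i + u ^ 2 ^ i * x)))"
    unfolding * by (subst sum.swap) (simp only: sum_distrib_left)
  also have "\<dots> = (\<Sum>u\<in>UNIV. \<chi> (v * u + u ^ d) * (if u ^ 2 ^ (i + i) = u then 2 ^ n else 0))"
    by (simp only: sum_chi_linearized frobenius_comp eq_commute)
  also have "\<dots> = (\<Sum>u\<in>{0,1}. \<chi> (v * u + u ^ d) * 2 ^ n)"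
    by (rule sum.mono_neutral_cong_right) (auto simp: frobenius_fixed_iff[OF coprime_2i])
  \<comment> \<open>The summand at \<open>u = 1\<close> carries
    \<open>\<chi> (v + 1) = - \<chi> v\<close>.\<close>
  also have "\<dots> = 2 ^ n * (1 - \<chi> v)" by (simp add: chi_add algebra_simps)
  finally show ?thesis .
qed

lemma char_sum_0: "char_sum a 0 = (if a = 0 then 2 ^ n else 0)"
  by (simp add: char_sum_def sum_chi_mult)

text \<open>Since every nonzero \<open>b\<close> is some \<open>c ^ d\<close>, this reduces the case
  \<open>b \<noteq> 0\<close> to \<open>b = 1\<close>.\<close>

lemma char_sum_rescale:
  assumes "c \<noteq> 0"
  shows "char_sum a (c ^ d) = char_sum (a / c) 1"
  unfolding char_sum_def
  by (rule sum.reindex_bij_witness[of _ "\<lambda>x. x / c" "\<lambda>x. c * x"])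
    (use assms in \<open>auto simp: power_mult_distrib mult_ac\<close>)

lemma sum_trace_pairing:
  "(\<Sum>s\<in>power_graph i. trace_pairing n s (a, b)) = of_real (char_sum a b)"
proof -
  have "(power_graph i :: ('a \<times> 'a) set) = range (\<lambda>x. (x, x ^ d))"
    by (auto simp: power_graph_def)
  then have "(\<Sum>s\<in>power_graph i. trace_pairing n s (a, b))
      = (\<Sum>x\<in>UNIV. trace_pairing n (x, x ^ d) (a, b))"
    by (simp add: sum.reindex inj_on_def)
  then show ?thesis
    by (simp add: trace_pairing_def sign_pow_abs_trace char_sum_def)
qed

section \<open>Formal self duality as a trace identity\<close>

lemma formally_self_dual_iff_char_sum:
  "formally_self_dual n (power_graph i :: ('a \<times> 'a) set)
     \<longleftrightarrow> (\<forall>a b. (char_sum a b)\<^sup>2 = 2 ^ n * real (card (differences (a, b))))"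
  by (simp add: formally_self_dual_def sum_trace_pairing card_power_graph card_UNIV
      differences_def)

lemma formally_self_dual_iff_Tr:
  "formally_self_dual n (power_graph i :: ('a \<times> 'a) set)
     \<longleftrightarrow> (\<forall>v::'a. v \<noteq> 0 \<longrightarrow> Tr v = Tr (inverse v ^ d))"
proof -
  have b_neq: "(char_sum a (c ^ d))\<^sup>2 = 2 ^ n * (1 - \<chi> (a / c))" if "c \<noteq> 0" for a c
    by (simp only: char_sum_rescale[OF that] char_sum_square)
  show ?thesis
    unfolding formally_self_dual_iff_char_sum
  proof (intro iffI allI impI)
    fix v :: 'a
    assume *: "\<forall>a b. (char_sum a b)\<^sup>2 = 2 ^ n * real (card (differences (a, b)))" and v: "v \<noteq> 0"
    have "2 ^ n * (1 - \<chi> (v / 1)) = 2 ^ n * real (card (differences (v, 1 ^ d)))"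
      by (metis * b_neq zero_neq_one)
    then have "\<chi> v = \<chi> (inverse v ^ d)"
      using v by (simp add: card_differences field_simps)
    then show "Tr v = Tr (inverse v ^ d)" by (simp only: chi_eq_iff)
  next
    fix a b :: 'a
    assume *: "\<forall>v::'a. v \<noteq> 0 \<longrightarrow> Tr v = Tr (inverse v ^ d)"
    show "(char_sum a b)\<^sup>2 = 2 ^ n * real (card (differences (a, b)))"
    proof (cases "b = 0")
      case True
      \<comment> \<open>Both sides vanish for \<open>a \<noteq> 0\<close>, the right one because
        \<open>\<chi> 0 = 1\<close>.\<close>
      then show ?thesis by (simp add: card_differences char_sum_0 power2_eq_square)
    next
      case False
      obtain c where c: "b = c ^ d" using bij_power_d by (metis bij_pointE)
      with False have "c \<noteq> 0" by auto
      moreover have "\<chi> (a / c) = \<chi> (b / a ^ d)" if "a \<noteq> 0"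
      proof -
        have "b / a ^ d = inverse (a / c) ^ d"
          by (simp only: c inverse_divide power_divide)
        moreover have "Tr (a / c) = Tr (inverse (a / c) ^ d)"
          by (rule *[rule_format]) (use that \<open>c \<noteq> 0\<close> in simp)
        ultimately show ?thesis by (simp only: chi_eq_iff)
      qed
      ultimately show ?thesis
        using False b_neq[of c a] unfolding card_differences c
        by (cases "a = 0") simp_all
    qed
  qed
qed

end

section \<open>Comparing the two traces\<close>

text \<open>By size: the sum is at most \<open>3 * 2 ^ (n - 2) + 1\<close>. For \<open>n = 3\<close>
  this fails, as \<open>4 + 2 + 1 = 7\<close>.\<close>

lemma not_dvd_sum_of_powers_of_2:
  fixes n j k :: nat
  assumes "n \<ge> 4" "j < n" "k < n" "j \<noteq> k"
  shows "\<not> (2 ^ n - 1) dvd (2 ^ j + 2 ^ k + 1 :: nat)"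
proof -
  have *: "(2::nat) ^ j + 2 ^ k + 1 < 2 ^ n - 1" if "j < k" "k < n" for j k
  proof -
    obtain m where m: "n = m + 2" "m \<ge> 2" using assms(1) by (intro that[of "n - 2"]) auto
    have "(2::nat) ^ j \<le> 2 ^ m" "(2::nat) ^ k \<le> 2 * 2 ^ m"
      using that m power_increasing[of j m "2::nat"] power_increasing[of k "m + 1" "2::nat"] by auto
    moreover have "(2::nat) ^ m \<ge> 4" using power_increasing[of 2 m "2::nat"] m by simp
    moreover have "(2::nat) ^ n = 4 * 2 ^ m" by (simp add: m)
    ultimately show ?thesis by linarith
  qed
  have "(2::nat) ^ j + 2 ^ k + 1 < 2 ^ n - 1"
    using *[of j k] *[of k j] assms by (cases j k rule: linorder_cases) (simp_all add: add.commute)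
  then show ?thesis by (auto dest: dvd_imp_le)
qed

context gold_function
begin

text \<open>The conjugate with index \<open>j\<close> contributes the power sum of exponent
  \<open>2 ^ j - 1\<close>, which vanishes for \<open>0 < j < n\<close>; index \<open>0\<close>
  counts the nonzero elements, an odd number.\<close>

lemma sum_Tr_div_self:
  "(\<Sum>v\<in>UNIV - {0}. Tr v * inverse v) = (1::'a)"
proof -
  have *: "(\<Sum>v\<in>UNIV - {0}. v ^ 2 ^ j * inverse v) = (if j = 0 then 1 else 0::'a)" if "j < n" for j
  proof -
    have eq: "(\<Sum>v\<in>UNIV - {0}. v ^ 2 ^ j * inverse v) = (\<Sum>v\<in>UNIV - {0::'a}. v ^ (2 ^ j - 1))"
      by (intro sum.cong refl) (auto simp: power_diff field_simps)
    show ?thesis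
    proof (cases "j = 0")
      case True
      have "of_nat (CARD('a) - 1) + (1::'a) = of_nat (CARD('a))"
        using finite_UNIV_card_ge_0[where ?'a = 'a]
        by (metis Suc_diff_1 Suc_eq_plus1 finite of_nat_1 of_nat_add)
      also have "\<dots> = 0"
        unfolding card_UNIV of_nat_eq_0_iff_char_dvd using n_pos by (simp add: CHAR_2)
      finally have "of_nat (CARD('a) - 1) = (1::'a)" by (simp only: add_eq_0_iff_eq)
      with True show ?thesis unfolding eq by simp
    next
      case False
      have "(2::nat) ^ j - 1 < 2 ^ n - 1"
        using that by (intro diff_less_mono power_strict_increasing) auto
      moreover have "(2::nat) ^ j - 1 > 0"
        using False one_less_power[of "2::nat" j] by simp
      ultimately have "\<not> (CARD('a) - 1) dvd (2 ^ j - 1)"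
        unfolding card_UNIV by (metis nat_dvd_not_less)
      with False show ?thesis unfolding eq by (simp add: finite_field_power_sum_eq_0)
    qed
  qed
  have "(\<Sum>v\<in>UNIV - {0}. Tr v * inverse v)
      = (\<Sum>j<n. \<Sum>v\<in>UNIV - {0::'a}. v ^ 2 ^ j * inverse v)"
    by (subst sum.swap) (simp add: abs_trace_def sum_distrib_right)
  also have "\<dots> = (\<Sum>j<n. if j = 0 then 1 else 0::'a)"
    by (intro sum.cong refl *) simp
  also have "\<dots> = 1" using n_pos by simp
  finally show ?thesis .
qed

lemma sum_Tr_inverse_div_self:
  assumes "n \<ge> 4"
  shows "(\<Sum>v\<in>UNIV - {0}. Tr (inverse v ^ d) * inverse v) = (0::'a)"
proof -
  have *: "(\<Sum>v\<in>UNIV - {0::'a}. (inverse v ^ d) ^ 2 ^ j * inverse v) = 0" if "j < n" for j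
  proof -
    \<comment> \<open>Frobenius has period \<open>n\<close>, so the exponent \<open>i + j\<close>
      may be reduced below \<open>n\<close>, as the size bound requires.\<close>
    define k where "k = (i + j) mod n"
    have "x ^ 2 ^ (i + j) = x ^ 2 ^ k" for x :: 'a
    proof -
      have "x ^ 2 ^ (i + j) = x ^ 2 ^ (n * ((i + j) div n) + k)" unfolding k_def by simp
      then show ?thesis by (simp only: frobenius_period flip: frobenius_comp)
    qed
    then have exponent: "(x ^ d) ^ 2 ^ j * x = x ^ (2 ^ k + 2 ^ j + 1)" for x :: 'a
      by (simp add: power_add power_mult_distrib power_commutes frobenius_comp mult_ac)
    have "k \<noteq> j"
    proof
      assume "k = j"
      then have "[i + j = 0 + j] (mod n)" using that by (simp add: k_def cong_def)
      then have "n dvd i" by (simp only: cong_add_rcancel_nat cong_0_iff)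
      then have "n = 1" using coprime_i by (metis coprime_common_divisor_nat dvd_refl)
      then show False using assms by simp
    qed
    moreover have "k < n" unfolding k_def using n_pos by simp
    ultimately have "\<not> (CARD('a) - 1) dvd (2 ^ k + 2 ^ j + 1)"
      unfolding card_UNIV using not_dvd_sum_of_powers_of_2[OF assms, of k j] that by auto
    then have "(\<Sum>v\<in>UNIV - {0::'a}. v ^ (2 ^ k + 2 ^ j + 1)) = 0"
      by (rule finite_field_power_sum_eq_0)
    moreover have "(\<Sum>v\<in>UNIV - {0::'a}. (inverse v ^ d) ^ 2 ^ j * inverse v)
        = (\<Sum>v\<in>UNIV - {0::'a}. v ^ (2 ^ k + 2 ^ j + 1))"
      unfolding exponent
      by (rule sum.reindex_bij_witness[of _ inverse inverse]) auto
    ultimately show ?thesis by simp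
  qed
  have "(\<Sum>v\<in>UNIV - {0}. Tr (inverse v ^ d) * inverse v)
      = (\<Sum>j<n. \<Sum>v\<in>UNIV - {0::'a}. (inverse v ^ d) ^ 2 ^ j * inverse v)"
    by (subst sum.swap) (simp only: abs_trace_def sum_distrib_right)
  then show ?thesis using * by simp
qed

lemma formally_self_dual_imp_le_3:
  assumes "formally_self_dual n (power_graph i :: ('a \<times> 'a) set)"
  shows "n \<le> 3"
proof (rule ccontr)
  assume "\<not> n \<le> 3"
  then have n: "n \<ge> 4" by simp
  have "(\<Sum>v\<in>UNIV - {0::'a}. Tr v * inverse v)
      = (\<Sum>v\<in>UNIV - {0}. Tr (inverse v ^ d) * inverse v)"
  proof (rule sum.cong[OF refl])
    fix v :: 'a assume "v \<in> UNIV - {0}"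
    then have "Tr v = Tr (inverse v ^ d)"
      by (intro assms[unfolded formally_self_dual_iff_Tr, rule_format]) simp
    then show "Tr v * inverse v = Tr (inverse v ^ d) * inverse v" by (rule arg_cong)
  qed
  then show False by (simp only: sum_Tr_div_self sum_Tr_inverse_div_self[OF n]) simp
qed

lemma formally_self_dual_3:
  assumes "n = 3" "i = 1 \<or> i = 2"
  shows "formally_self_dual n (power_graph i :: ('a \<times> 'a) set)"
  unfolding formally_self_dual_iff_Tr
proof (intro allI impI)
  fix v :: 'a assume v: "v \<noteq> 0"
  then have v7: "v ^ 7 = 1"
    using finite_field_power_card_minus_1[of v] by (simp add: card_UNIV assms)
  obtain k :: nat where k: "2 ^ k + d = 7"
  proof (cases "i = 1")
    case True
    then show ?thesis by (intro that[of 2]) simp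
  next
    case False
    \<comment> \<open>The two decompositions are \<open>7 = 4 + 3\<close> for \<open>i = 1\<close>
      and \<open>7 = 2 + 5\<close> for \<open>i = 2\<close>.\<close>
    then show ?thesis using assms by (intro that[of 1]) simp
  qed
  have "v ^ 2 ^ k * v ^ d = 1" by (simp only: k v7 flip: power_add)
  then have "inverse v ^ d = v ^ 2 ^ k"
    using v by (metis inverse_unique mult.commute power_inverse)
  then show "Tr v = Tr (inverse v ^ d)" by (simp only: Tr_frobenius)
qed

end

theorem theorem6p12:
  fixes n i :: nat
  assumes "CARD('a::finite_field) = 2 ^ n"
    and "odd n"
    and "1 \<le> i" and "i < n" and "gcd i n = 1"
  shows "(formally_self_dual n (power_graph i :: ('a \<times> 'a) set) \<longleftrightarrow> n = 3) \<and>
         (n = 3 \<longrightarrow> formally_self_dual n (power_graph 1 :: ('a \<times> 'a) set) \<and>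
                    formally_self_dual n (power_graph 2 :: ('a \<times> 'a) set))"
proof -
  \<comment> \<open>Stated for every \<open>k\<close>, since the last claim concerns the exponents
    \<open>1\<close> and \<open>2\<close> rather than \<open>i\<close>.\<close>
  have gold: "gold_function TYPE('a) n k" if "coprime k n" for k
    using assms that by unfold_locales auto
  have i: "coprime i n" using assms by (simp add: coprime_iff_gcd_eq_1)
  have three: "formally_self_dual n (power_graph k :: ('a \<times> 'a) set)"
    if "n = 3" "k = 1 \<or> k = 2" for k
    using gold_function.formally_self_dual_3[OF gold, of k] that assms(2) by auto
  have "n = 3" if "formally_self_dual n (power_graph i :: ('a \<times> 'a) set)"
  proof -
    have "n \<le> 3" using gold_function.formally_self_dual_imp_le_3[OF gold[OF i] that] .
    \<comment> \<open>The value \<open>n = 1\<close> is excluded by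
      \<open>1 \<le> i < n\<close>.\<close>
    moreover have "n \<noteq> 2" using assms(2) by auto
    ultimately show ?thesis using assms by linarith
  qed
  moreover have "i = 1 \<or> i = 2" if "n = 3" using assms that by auto
  ultimately show ?thesis using three by blast
qed

end
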